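(* Consider the classical secretary problem with non-negative random weights drawn i.i.d. from a known distribution, where the algorithm must irrevocably select at most one candidate upon arrival, aiming to maximize the expected weight of the selected candidate, and where the number of candidates $n$ is chosen adversarially in $\{1,\dots,N\}$ ($N$ known, $n$ unknown in advance). Then (for a suitably chosen distribution) no algorithm achieves better than a $\frac{\log N}{32\log\log N}$-approximation in expectation; i.e. for every algorithm there is $n\in\{1,\dots,N\}$ for which the expected weight selected among the first $n$ candidates is at most $\frac{32\log\log N}{\log N}$ times the expected maximum weight among the first $n$ candidates.
   Context: $\log$ is base 2. *)

theory Defs
  imports "HOL-Probability.Probability"
begin

text \<open>
  Positivity and finiteness of the mean exclude degenerate laws (the point mass at 0, or laws
  whose Bochner integral is 0 by convention) for which any approximation bound holds vacuously.
\<close>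
definition weight_distribution :: "real measure \<Rightarrow> bool" where
  "weight_distribution D \<longleftrightarrow>
     prob_space D \<and> sets D = sets borel \<and> (AE x in D. 0 \<le> x) \<and>
     integrable D (\<lambda>x. x) \<and> 0 < (\<integral>x. x \<partial>D)"

text \<open>
  A randomized algorithm draws a seed \<open>r\<close> from a law \<open>R\<close>, independently of the weights.
  \<open>A i (r, h)\<close> says whether candidate \<open>i\<close> is taken (provided that nobody has been taken before),
  where \<open>h\<close>, a function on \<open>{1..i}\<close>, consists of the weights of the candidates seen so far.
  The number of candidates that will arrive is not an argument of \<open>A\<close>.
\<close>
definition online_algorithm ::
    "nat \<Rightarrow> real measure \<Rightarrow> (nat \<Rightarrow> real \<times> (nat \<Rightarrow> real) \<Rightarrow> bool) \<Rightarrow> bool" where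
  "online_algorithm N R A \<longleftrightarrow>
     prob_space R \<and> sets R = sets borel \<and>
     (\<forall>i\<in>{1..N}. Measurable.pred (R \<Otimes>\<^sub>M (\<Pi>\<^sub>M j\<in>{1..i}. borel)) (A i))"

definition selects ::
    "(nat \<Rightarrow> real \<times> (nat \<Rightarrow> real) \<Rightarrow> bool) \<Rightarrow> real \<Rightarrow> (nat \<Rightarrow> real) \<Rightarrow> nat \<Rightarrow> bool" where
  "selects A r w i \<longleftrightarrow>
     A i (r, restrict w {1..i}) \<and> (\<forall>j\<in>{1..<i}. \<not> A j (r, restrict w {1..j}))"

text \<open>At most one summand is nonzero; the sum is 0 if none of the first \<open>n\<close> candidates is taken.\<close>
definition selected_weight ::
    "(nat \<Rightarrow> real \<times> (nat \<Rightarrow> real) \<Rightarrow> bool) \<Rightarrow> nat \<Rightarrow> real \<Rightarrow> (nat \<Rightarrow> real) \<Rightarrow> real" where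
  "selected_weight A n r w = (\<Sum>i\<in>{1..n}. if selects A r w i then w i else 0)"

definition expected_selected ::
    "nat \<Rightarrow> real measure \<Rightarrow> real measure \<Rightarrow> (nat \<Rightarrow> real \<times> (nat \<Rightarrow> real) \<Rightarrow> bool) \<Rightarrow> nat \<Rightarrow> real" where
  "expected_selected N D R A n =
     (\<integral>(r, w). selected_weight A n r w \<partial>(R \<Otimes>\<^sub>M (\<Pi>\<^sub>M j\<in>{1..N}. D)))"

definition expected_max :: "nat \<Rightarrow> real measure \<Rightarrow> nat \<Rightarrow> real" where
  "expected_max N D n = (\<integral>w. Max (w ` {1..n}) \<partial>(\<Pi>\<^sub>M j\<in>{1..N}. D))"

end

theory Submission
  imports Defs
begin

text \<open>
  Let the weight be \<open>2 ^ G\<close> where \<open>P (G \<ge> k) = B powr (-k)\<close>, with \<open>B\<close> a power of two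
  slightly larger than \<open>log N\<close>. The expected maximum of \<open>B ^ k\<close> weights is at least \<open>2 ^ k / 2\<close>,
  so an algorithm that is \<open>c\<close>-competitive at all times \<open>B ^ k \<le> N\<close>, \<open>k \<le> K\<close>, satisfies
  \<open>(\<Sum>k\<le>K. 2 powr (-k) * E (selected weight at time B ^ k)) \<ge> c * (K + 1) / 2\<close>.
  On the other hand, at most one candidate \<open>i\<close> contributes to this sum, with its weight multiplied by
  \<open>L i = (\<Sum>k | i \<le> B ^ k. 2 powr (-k))\<close>. The sum is therefore at most
  \<open>2 + (\<Sum>i. (L i * w i) * 1 {L i * w i > 2})\<close> pointwise, whatever the algorithm does, and the
  tail expectations add up to \<open>O (K / B) = O (1)\<close>. Hence \<open>c = O (1 / K)\<close>, where
  \<open>K \<approx> log N / log log N\<close>.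
\<close>

section \<open>Pointwise bound on weighted combinations of stopping times\<close>

lemma selects_unique: "selects A r w i \<Longrightarrow> selects A r w j \<Longrightarrow> 1 \<le> i \<Longrightarrow> 1 \<le> j \<Longrightarrow> i = j"
  unfolding selects_def by (metis atLeastLessThan_iff nat_neq_iff)

text \<open>After exchanging the sums, candidate \<open>i\<close> carries the total weight
  \<open>L i\<close> of the times at which it has already arrived. As only one candidate is ever
  selected, the left side is a single \<open>L j * w j\<close>. It is either at most
  \<open>a\<close> or one of the summands on the right. The bound no longer mentions the
  algorithm.\<close>

lemma weighted_selected_weight_le:
  fixes lam :: "'k \<Rightarrow> real" and t :: "'k \<Rightarrow> nat" and a :: real
  assumes "finite I" and lam: "\<And>k. k \<in> I \<Longrightarrow> 0 \<le> lam k" and t: "\<And>k. k \<in> I \<Longrightarrow> t k \<le> N" and "0 \<le> a"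
  defines "L \<equiv> \<lambda>i. \<Sum>k\<in>{k\<in>I. i \<le> t k}. lam k"
  shows "(\<Sum>k\<in>I. lam k * selected_weight A (t k) r w)
           \<le> a + (\<Sum>i\<in>{1..N}. if a < L i * w i then L i * w i else 0)"
proof -
  \<comment> \<open>All sums are padded to the common range \<open>{1..N}\<close>, so that the order
    of summation can be exchanged.\<close>
  have sel: "selected_weight A (t k) r w = 
      (\<Sum>i\<in>{1..N}. if i \<le> t k then (if selects A r w i then w i else 0) else 0)" if "k \<in> I" for k
    unfolding selected_weight_def
    using t[OF that] by (intro sum.mono_neutral_cong_left) auto
  have "(\<Sum>k\<in>I. lam k * selected_weight A (t k) r w) 
      = (\<Sum>k\<in>I. \<Sum>i\<in>{1..N}. lam k * (if i \<le> t k then (if selects A r w i then w i else 0) else 0))"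
    by (intro sum.cong refl) (simp add: sel sum_distrib_left)
  also have "\<dots> = (\<Sum>i\<in>{1..N}. \<Sum>k\<in>I. lam k * (if i \<le> t k then (if selects A r w i then w i else 0) else 0))"
    by (rule sum.swap)
  also have "\<dots> = (\<Sum>i\<in>{1..N}. if selects A r w i then L i * w i else 0)"
    unfolding L_def sum.inter_filter[OF \<open>finite I\<close>]
    by (intro sum.cong refl) (auto simp: sum_distrib_right intro!: sum.cong)
  also have "\<dots> \<le> a + (\<Sum>i\<in>{1..N}. if a < L i * w i then L i * w i else 0)" (is "_ \<le> a + ?R")
  proof -
    have nn: "0 \<le> (if a < L i * w i then L i * w i else 0)" for i
      using \<open>0 \<le> a\<close> by simp
    show ?thesis
    proof (cases "\<exists>i\<in>{1..N}. selects A r w i")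
      case False
      then have "(\<Sum>i\<in>{1..N}. if selects A r w i then L i * w i else 0) = 0"
        by (intro sum.neutral) auto
      moreover have "0 \<le> ?R"
        by (intro sum_nonneg nn)
      ultimately show ?thesis
        using \<open>0 \<le> a\<close> by linarith
    next
      case True
      then obtain j where j: "j \<in> {1..N}" "selects A r w j" by blast
      have "(\<Sum>i\<in>{1..N}. if selects A r w i then L i * w i else 0)
          = (\<Sum>i\<in>{1..N}. if i = j then L i * w i else 0)"
        using j selects_unique[of A r w] by (intro sum.cong refl) auto
      also have "\<dots> = L j * w j"
        using j by simp
      also have "\<dots> \<le> a + (if a < L j * w j then L j * w j else 0)"
        using \<open>0 \<le> a\<close> by simp
      also have "\<dots> \<le> a + ?R"
        using j by (intro add_left_mono member_le_sum nn) auto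
      finally show ?thesis .
    qed
  qed
  finally show ?thesis .
qed

section \<open>Expectations over the seed and the weights\<close>

lemma weight_distributionD:
  assumes "weight_distribution D"
  shows "prob_space D" "sets D = sets borel" "space D = UNIV" "AE x in D. 0 \<le> x"
    "integrable D (\<lambda>x. x)"
  using assms sets_eq_imp_space_eq[of D borel] by (auto simp: weight_distribution_def)

lemma (in prob_space) distr_pair_snd:
  assumes "sigma_finite_measure N"
  shows "distr (M \<Otimes>\<^sub>M N) N snd = N"
proof (rule measure_eqI)
  fix A assume "A \<in> sets (distr (M \<Otimes>\<^sub>M N) N snd)"
  then have A: "A \<in> sets N" by simp
  have "snd -` A \<inter> space (M \<Otimes>\<^sub>M N) = space M \<times> A"
    using sets.sets_into_space[OF A] by (auto simp: space_pair_measure)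
  then show "emeasure (distr (M \<Otimes>\<^sub>M N) N snd) A = emeasure N A"
    using A by (simp add: emeasure_distr emeasure_space_1
        sigma_finite_measure.emeasure_pair_measure_Times[OF assms])
qed simp

lemma distr_seed_weights_component:
  assumes "prob_space R" "prob_space D" "i \<in> I"
  shows "distr (R \<Otimes>\<^sub>M (\<Pi>\<^sub>M j\<in>I. D)) D (\<lambda>x. snd x i) = D"
proof -
  let ?P = "\<Pi>\<^sub>M j\<in>I. D"
  have P: "prob_space ?P" using assms by (intro prob_space_PiM) auto
  have "distr (R \<Otimes>\<^sub>M ?P) D (\<lambda>x. snd x i) = distr (distr (R \<Otimes>\<^sub>M ?P) ?P snd) D (\<lambda>w. w i)"
    using assms by (subst distr_distr) (auto simp: comp_def)
  also have "\<dots> = D"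
    using assms P distr_PiM_component[of I "\<lambda>_. D" i]
    by (simp add: prob_space.distr_pair_snd prob_space_imp_sigma_finite)
  finally show ?thesis .
qed

lemma integrable_seed_weights_component:
  fixes f :: "real \<Rightarrow> real"
  assumes "prob_space R" "prob_space D" "i \<in> I" "integrable D f"
  shows "integrable (R \<Otimes>\<^sub>M (\<Pi>\<^sub>M j\<in>I. D)) (\<lambda>x. f (snd x i))"
    and "(\<integral>x. f (snd x i) \<partial>(R \<Otimes>\<^sub>M (\<Pi>\<^sub>M j\<in>I. D))) = (\<integral>x. f x \<partial>D)"
proof -
  have m: "(\<lambda>x. snd x i) \<in> measurable (R \<Otimes>\<^sub>M (\<Pi>\<^sub>M j\<in>I. D)) D"
    using assms(3) by simp
  note d = distr_seed_weights_component[OF assms(1-3)]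
  show "integrable (R \<Otimes>\<^sub>M (\<Pi>\<^sub>M j\<in>I. D)) (\<lambda>x. f (snd x i))"
    using integrable_distr[OF m, of f] assms(4) by (simp add: d)
  show "(\<integral>x. f (snd x i) \<partial>(R \<Otimes>\<^sub>M (\<Pi>\<^sub>M j\<in>I. D))) = (\<integral>x. f x \<partial>D)"
    using integral_distr[OF m, of f] assms(4) by (simp add: d)
qed

lemma pred_selects:
  assumes alg: "online_algorithm N R A" and D: "sets D = sets borel" and i: "i \<in> {1..N}"
  shows "Measurable.pred (R \<Otimes>\<^sub>M (\<Pi>\<^sub>M j\<in>{1..N}. D)) (\<lambda>x. selects A (fst x) (snd x) i)"
proof -
  let ?M = "R \<Otimes>\<^sub>M (\<Pi>\<^sub>M j\<in>{1..N}. D)"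
  have A: "Measurable.pred ?M (\<lambda>x. A j (fst x, restrict (snd x) {1..j}))" if j: "j \<in> {1..N}" for j
  proof -
    have "(\<lambda>x. restrict (snd x) {1..j}) \<in> measurable ?M (\<Pi>\<^sub>M j\<in>{1..j}. borel)"
    proof (rule measurable_restrict)
      fix l assume "l \<in> {1..j}"
      then have "(\<lambda>x. snd x l) \<in> measurable ?M D"
        using j by simp
      then show "(\<lambda>x. snd x l) \<in> borel_measurable ?M"
        using D by (simp cong: measurable_cong_sets)
    qed
    then have "(\<lambda>x. (fst x, restrict (snd x) {1..j})) \<in> measurable ?M (R \<Otimes>\<^sub>M (\<Pi>\<^sub>M j\<in>{1..j}. borel))"
      by simp
    moreover have "Measurable.pred (R \<Otimes>\<^sub>M (\<Pi>\<^sub>M j\<in>{1..j}. borel)) (A j)"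
      using alg j by (auto simp: online_algorithm_def)
    ultimately show ?thesis
      by (rule measurable_compose)
  qed
  show ?thesis
    unfolding selects_def using A i by (intro pred_intros_logic pred_intros_finite) auto
qed

text \<open>Each summand is dominated by the absolute value of a single weight, whose law has finite
  mean.\<close>

lemma integrable_selected_weight:
  assumes alg: "online_algorithm N R A" and D: "weight_distribution D" and n: "n \<le> N"
  shows "integrable (R \<Otimes>\<^sub>M (\<Pi>\<^sub>M j\<in>{1..N}. D)) (\<lambda>x. selected_weight A n (fst x) (snd x))"
  unfolding selected_weight_def
proof (rule Bochner_Integration.integrable_sum)
  fix i assume "i \<in> {1..n}"
  then have i: "i \<in> {1..N}" using n by simp
  let ?M = "R \<Otimes>\<^sub>M (\<Pi>\<^sub>M j\<in>{1..N}. D)"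
  note D' = weight_distributionD[OF D]
  have R: "prob_space R" using alg by (simp add: online_algorithm_def)
  have int: "integrable ?M (\<lambda>x. snd x i)"
    using integrable_seed_weights_component(1)[OF R D'(1) i D'(5)] by simp
  note [measurable] = pred_selects[OF alg D'(2) i] borel_measurable_integrable[OF int]
  show "integrable ?M (\<lambda>x. if selects A (fst x) (snd x) i then snd x i else 0)"
  proof (rule Bochner_Integration.integrable_bound[OF int])
    show "(\<lambda>x. if selects A (fst x) (snd x) i then snd x i else 0) \<in> borel_measurable ?M"
      by measurable
  qed auto
qed

text \<open>The pointwise bound is integrated. Each summand of its right side depends on one weight
  only, so the expectation reduces to integrals over the marginal \<open>D\<close>; neither the seed
  nor the joint law survives.\<close>

lemma weighted_expected_selected_le:
  fixes lam :: "'k \<Rightarrow> real" and t :: "'k \<Rightarrow> nat" and a :: real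
  assumes alg: "online_algorithm N R A" and D: "weight_distribution D"
    and I: "finite I" "\<And>k. k \<in> I \<Longrightarrow> 0 \<le> lam k" "\<And>k. k \<in> I \<Longrightarrow> t k \<le> N" and a: "0 \<le> a"
  defines "L \<equiv> \<lambda>i. \<Sum>k\<in>{k\<in>I. i \<le> t k}. lam k"
  shows "(\<Sum>k\<in>I. lam k * expected_selected N D R A (t k))
           \<le> a + (\<Sum>i\<in>{1..N}. \<integral>x. (if a < L i * x then L i * x else 0) \<partial>D)"
proof -
  let ?M = "R \<Otimes>\<^sub>M (\<Pi>\<^sub>M j\<in>{1..N}. D)"
  let ?u = "\<lambda>i x. if a < L i * x then L i * x else 0"
  note D' = weight_distributionD[OF D]
  have R: "prob_space R" using alg by (simp add: online_algorithm_def)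
  interpret D: prob_space D by fact
  interpret R: prob_space R by fact
  interpret P: prob_space "\<Pi>\<^sub>M j\<in>{1..N}. D" by (intro prob_space_PiM D'(1))
  interpret M: pair_prob_space R "\<Pi>\<^sub>M j\<in>{1..N}. D" ..
  have iu: "integrable D (?u i)" for i
  proof (rule Bochner_Integration.integrable_bound)
    show "integrable D (\<lambda>x. L i * x)" using D'(5) by simp
    show "?u i \<in> borel_measurable D" using D'(2) by (simp cong: measurable_cong_sets)
  qed auto
  note iM = integrable_seed_weights_component[OF R D'(1) _ iu]
  have "(\<Sum>k\<in>I. lam k * expected_selected N D R A (t k))
      = (\<integral>x. (\<Sum>k\<in>I. lam k * selected_weight A (t k) (fst x) (snd x)) \<partial>?M)"
    unfolding expected_selected_def case_prod_beta
    using integrable_selected_weight[OF alg D I(3)] by (subst Bochner_Integration.integral_sum) auto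
  also have "\<dots> \<le> (\<integral>x. a + (\<Sum>i\<in>{1..N}. ?u i (snd x i)) \<partial>?M)"
  proof (rule integral_mono)
    show "integrable ?M (\<lambda>x. \<Sum>k\<in>I. lam k * selected_weight A (t k) (fst x) (snd x))"
      using integrable_selected_weight[OF alg D I(3)] by auto
    show "integrable ?M (\<lambda>x. a + (\<Sum>i\<in>{1..N}. ?u i (snd x i)))"
      by (intro Bochner_Integration.integrable_add Bochner_Integration.integrable_sum
          M.integrable_const iM(1))
  qed (unfold L_def, rule weighted_selected_weight_le[OF I a])
  also have "\<dots> = (\<integral>x. a \<partial>?M) + (\<integral>x. (\<Sum>i\<in>{1..N}. ?u i (snd x i)) \<partial>?M)"
    by (intro Bochner_Integration.integral_add Bochner_Integration.integrable_sum
          M.integrable_const iM(1))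
  also have "(\<integral>x. a \<partial>?M) = a"
    using M.prob_space by simp
  also have "(\<integral>x. (\<Sum>i\<in>{1..N}. ?u i (snd x i)) \<partial>?M) = (\<Sum>i\<in>{1..N}. \<integral>x. ?u i x \<partial>D)"
    by (subst Bochner_Integration.integral_sum) (rule iM(1), assumption, rule sum.cong[OF refl iM(2)])
  finally show ?thesis .
qed

section \<open>Lower bound on the expected maximum\<close>

lemma integrable_component:
  assumes "weight_distribution D" "i \<in> {1..N}"
  shows "integrable (\<Pi>\<^sub>M j\<in>{1..N}. D) (\<lambda>w. w i)"
    and "(\<integral>w. w i \<partial>(\<Pi>\<^sub>M j\<in>{1..N}. D)) = (\<integral>x. x \<partial>D)"
proof -
  note D' = weight_distributionD[OF assms(1)]
  have d: "distr (\<Pi>\<^sub>M j\<in>{1..N}. D) D (\<lambda>w. w i) = D"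
    by (rule distr_PiM_component) (use D'(1) assms in auto)
  have m: "(\<lambda>w. w i) \<in> measurable (\<Pi>\<^sub>M j\<in>{1..N}. D) D"
    using assms by simp
  show "integrable (\<Pi>\<^sub>M j\<in>{1..N}. D) (\<lambda>w. w i)"
    using integrable_distr[OF m, of "\<lambda>x. x"] D'(5) by (simp add: d)
  show "(\<integral>w. w i \<partial>(\<Pi>\<^sub>M j\<in>{1..N}. D)) = (\<integral>x. x \<partial>D)"
    using integral_distr[OF m, of "\<lambda>x. x"] D'(5) by (simp add: d)
qed

lemma expected_max_1:
  assumes "weight_distribution D" "1 \<le> N"
  shows "expected_max N D 1 = (\<integral>x. x \<partial>D)"
  using integrable_component(2)[OF assms(1), of 1 N] assms(2) by (simp add: expected_max_def)

text \<open>By independence, all of the first \<open>n\<close> weights fall below \<open>v\<close>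
  with probability \<open>measure D {..<v} ^ n\<close>. Off this event the maximum is at least
  \<open>v\<close>; on it the maximum is almost surely non-negative.\<close>

lemma expected_max_ge:
  assumes D: "weight_distribution D" and n: "1 \<le> n" "n \<le> N" and v: "0 \<le> v"
  shows "v * (1 - measure D {..<v} ^ n) \<le> expected_max N D n"
proof -
  let ?P = "\<Pi>\<^sub>M j\<in>{1..N}. D"
  note D' = weight_distributionD[OF D]
  interpret D: prob_space D by fact
  interpret P: product_prob_space "\<lambda>_. D" "{1..N}" by standard
  note int = integrable_component(1)[OF D]
  define E where "E = {w \<in> space ?P. \<forall>i\<in>{1..n}. w i \<in> {..<v}}"
  have E: "E \<in> sets ?P"
    unfolding E_def
  proof (rule sets.sets_Collect_finite_All)
    fix i assume "i \<in> {1..n}"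
    then have [measurable]: "(\<lambda>w. w i) \<in> borel_measurable ?P"
      using n by (intro borel_measurable_integrable[OF int]) auto
    show "{w \<in> space ?P. w i \<in> {..<v}} \<in> sets ?P"
      by measurable
  qed simp
  have "emeasure ?P E = ennreal (measure D {..<v} ^ n)"
    unfolding E_def using n D'(2) 
    by (subst P.emeasure_PiM_Collect) (auto simp: D.emeasure_eq_measure ennreal_power)
  then have mE: "measure ?P E = measure D {..<v} ^ n"
    by (simp add: measure_def)
  have max_int: "integrable ?P (\<lambda>w. Max (w ` {1..n}))"
  proof (rule Bochner_Integration.integrable_bound)
    show "integrable ?P (\<lambda>w. \<Sum>i\<in>{1..n}. \<bar>w i\<bar>)"
      using n by (intro Bochner_Integration.integrable_sum integrable_abs int) auto
    show "(\<lambda>w. Max (w ` {1..n})) \<in> borel_measurable ?P"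
      using n by (intro borel_measurable_Max borel_measurable_integrable[OF int]) auto
    show "AE w in ?P. norm (Max (w ` {1..n})) \<le> norm (\<Sum>i\<in>{1..n}. \<bar>w i\<bar>)"
    proof (rule AE_I2)
      fix w :: "nat \<Rightarrow> real"
      have "Max (w ` {1..n}) \<in> w ` {1..n}" using n by (intro Max_in) auto
      then obtain i where i: "i \<in> {1..n}" "Max (w ` {1..n}) = w i" by auto
      have "\<bar>w i\<bar> \<le> (\<Sum>i\<in>{1..n}. \<bar>w i\<bar>)" using i by (intro member_le_sum) auto
      then show "norm (Max (w ` {1..n})) \<le> norm (\<Sum>i\<in>{1..n}. \<bar>w i\<bar>)" using i by simp
    qed
  qed
  have "v * (1 - measure D {..<v} ^ n) = (\<integral>w. v * indicator (space ?P - E) w \<partial>?P)"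
    using P.P.prob_compl[OF E] mE E by simp
  also have "\<dots> \<le> expected_max N D n"
    unfolding expected_max_def
  proof (rule integral_mono_AE[OF _ max_int])
    show "integrable ?P (\<lambda>w. v * indicator (space ?P - E) w)"
      using E P.P.emeasure_finite[of "space ?P - E"]
      by (intro integrable_mult_right integrable_real_indicator) (auto simp: less_top)
    \<comment> \<open>Non-negativity of one weight among the first \<open>n\<close> already makes
      the maximum non-negative.\<close>
    have "AE w in ?P. 0 \<le> w 1"
      using D' n by (intro AE_PiM_component) auto
    then show "AE w in ?P. v * indicator (space ?P - E) w \<le> Max (w ` {1..n})"
    proof (eventually_elim)
      case (elim w)
      have ge: "w i \<le> Max (w ` {1..n})" if "i \<in> {1..n}" for i using that by simp
      show ?case
      proof (cases "w \<in> space ?P - E")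
        case True
        then obtain i where i: "i \<in> {1..n}" "v \<le> w i" unfolding E_def by force
        have "v \<le> Max (w ` {1..n})" using ge[OF i(1)] i(2) by linarith
        with True show ?thesis by simp
      next
        case False
        have "0 \<le> Max (w ` {1..n})" by (rule order_trans[OF elim ge]) (use n in simp)
        with False show ?thesis by simp
      qed
    qed
  qed
  finally show ?thesis .
qed

section \<open>The hard distribution\<close>

text \<open>The geometric law starts at 0, so the exponent is at least \<open>k\<close> with
  probability \<open>1 / B ^ k\<close>. Each doubling of the weight is thus \<open>B\<close> times
  rarer, and the mean is finite for \<open>B > 2\<close>.\<close>

definition dyadic_law :: "nat \<Rightarrow> real measure" where
  "dyadic_law B = distr (measure_pmf (geometric_pmf (1 - 1 / real B))) borel (\<lambda>n. 2 ^ n)"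

lemma integral_pmf_nat:
  fixes p :: "nat pmf" and f :: "nat \<Rightarrow> real"
  assumes "\<And>n. 0 \<le> f n" "(\<lambda>n. pmf p n * f n) sums s"
  shows "integrable (measure_pmf p) f" "(\<integral>n. f n \<partial>measure_pmf p) = s"
proof -
  have 1: "integrable (count_space UNIV) (\<lambda>n. pmf p n * f n)"
    using assms by (simp add: integrable_count_space_nat_iff sums_iff)
  then show "integrable (measure_pmf p) f"
    unfolding measure_pmf_eq_density by (subst integrable_density) auto
  have "(\<integral>n. f n \<partial>measure_pmf p) = (\<integral>n. pmf p n * f n \<partial>count_space UNIV)"
    unfolding measure_pmf_eq_density by (subst integral_density) auto
  also have "\<dots> = s"
    using assms(2) by (simp add: integral_count_space_nat[OF 1] sums_iff)
  finally show "(\<integral>n. f n \<partial>measure_pmf p) = s" .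
qed

lemma geometric_tail_sums:
  fixes c :: real
  assumes "\<bar>c\<bar> < 1"
  shows "(\<lambda>n. if g \<le> n then c ^ n else 0) sums (c ^ g / (1 - c))"
proof -
  have "(\<lambda>n. c ^ g * c ^ n) sums (c ^ g * (1 / (1 - c)))"
    using assms by (intro sums_mult geometric_sums) simp
  then have "(\<lambda>n. if g \<le> n + g then c ^ (n + g) else 0) sums (c ^ g / (1 - c))"
    by (simp add: power_add mult.commute)
  then show ?thesis
    by (subst (asm) sums_iff_shift) simp
qed

text \<open>The weights above \<open>2 ^ g\<close> are those with exponent at least
  \<open>Suc g\<close>, and the expectation is a geometric tail of ratio \<open>2 / B\<close>. The
  factor 2 absorbs \<open>(1 - 1 / B) / (1 - 2 / B)\<close>, which is at most 3/2 for
  \<open>B \<ge> 4\<close>.\<close>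

lemma dyadic_law_tail:
  assumes B: "4 \<le> B"
  shows "integrable (dyadic_law B) (\<lambda>x. if 2 ^ g < x then x else 0)"
    and "(\<integral>x. (if 2 ^ g < x then x else 0) \<partial>dyadic_law B) \<le> 2 * (2 / real B) ^ Suc g"
proof -
  let ?p = "1 - 1 / real B" and ?f = "\<lambda>x::real. if 2 ^ g < x then x else 0"
  have p: "0 < ?p" "?p \<le> 1" using B by (auto simp: field_simps)
  have c: "\<bar>2 / real B\<bar> < 1" using B by (simp add: field_simps)
  have "(\<lambda>n. ?p * (if Suc g \<le> n then (2 / real B) ^ n else 0))
      sums (?p * ((2 / real B) ^ Suc g / (1 - 2 / real B)))"
    by (intro sums_mult geometric_tail_sums c)
  also have "(\<lambda>n. ?p * (if Suc g \<le> n then (2 / real B) ^ n else 0))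
      = (\<lambda>n. pmf (geometric_pmf ?p) n * ?f (2 ^ n))"
    using p by (auto simp: fun_eq_iff Suc_le_eq power_divide)
  finally have s: "(\<lambda>n. pmf (geometric_pmf ?p) n * ?f (2 ^ n))
      sums (?p * ((2 / real B) ^ Suc g / (1 - 2 / real B)))" .
  have i: "integrable (measure_pmf (geometric_pmf ?p)) (\<lambda>n. ?f (2 ^ n))"
    and v: "(\<integral>n. ?f (2 ^ n) \<partial>measure_pmf (geometric_pmf ?p)) = ?p * ((2 / real B) ^ Suc g / (1 - 2 / real B))"
    by (rule integral_pmf_nat[OF _ s]; simp)+
  show "integrable (dyadic_law B) ?f"
    unfolding dyadic_law_def using i by (subst integrable_distr_eq) auto
  have "(\<integral>x. ?f x \<partial>dyadic_law B) = ?p * ((2 / real B) ^ Suc g / (1 - 2 / real B))"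
    unfolding dyadic_law_def v[symmetric] by (intro integral_distr) auto
  also have "\<dots> = (?p / (1 - 2 / real B)) * (2 / real B) ^ Suc g"
    by simp
  also have "\<dots> \<le> 2 * (2 / real B) ^ Suc g"
    using B by (intro mult_right_mono) (auto simp: field_simps)
  finally show "(\<integral>x. ?f x \<partial>dyadic_law B) \<le> 2 * (2 / real B) ^ Suc g" .
qed

lemma AE_dyadic_law: "AE x in dyadic_law B. 1 \<le> x"
  unfolding dyadic_law_def by (subst AE_distr_iff) auto

lemma weight_distribution_dyadic_law:
  assumes B: "4 \<le> B"
  shows "weight_distribution (dyadic_law B)"
proof -
  let ?p = "1 - 1 / real B"
  have p: "0 < ?p" "?p \<le> 1" using B by (auto simp: field_simps)
  have ps: "prob_space (dyadic_law B)"
    unfolding dyadic_law_def by (intro measure_pmf.prob_space_distr) simp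
  interpret prob_space "dyadic_law B" by fact
  have sets: "sets (dyadic_law B) = sets borel"
    by (simp add: dyadic_law_def)
  have int: "integrable (dyadic_law B) (\<lambda>x. x)"
  proof (rule Bochner_Integration.integrable_bound)
    \<comment> \<open>Weights are at least 1, so the value 1 escapes the tail at
      \<open>g = 0\<close>; the added constant covers it.\<close>
    show "integrable (dyadic_law B) (\<lambda>x. 1 + (if 2 ^ 0 < x then x else 0))"
      by (intro Bochner_Integration.integrable_add integrable_const dyadic_law_tail B)
    show "(\<lambda>x. x) \<in> borel_measurable (dyadic_law B)"
      using sets by (simp cong: measurable_cong_sets)
    show "AE x in dyadic_law B. norm x \<le> norm (1 + (if 2 ^ 0 < x then x else 0))"
      using AE_dyadic_law[of B] by eventually_elim auto
  qed
  have "1 = (\<integral>x. (1 :: real) \<partial>dyadic_law B)"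
    by (simp add: prob_space)
  also have "\<dots> \<le> (\<integral>x. x \<partial>dyadic_law B)"
    using AE_dyadic_law[of B] by (intro integral_mono_AE int) auto
  finally show ?thesis
    using ps sets int AE_dyadic_law[of B] unfolding weight_distribution_def by auto
qed

lemma measure_dyadic_law_lessThan:
  assumes B: "4 \<le> B"
  shows "measure (dyadic_law B) {..<2 ^ k} = 1 - 1 / real B ^ k"
proof -
  let ?p = "1 - 1 / real B"
  have p: "0 < ?p" "?p \<le> 1" using B by (auto simp: field_simps)
  have "measure (dyadic_law B) {..<2 ^ k} = measure (measure_pmf (geometric_pmf ?p)) {..<k}"
    unfolding dyadic_law_def by (subst measure_distr) (auto intro!: arg_cong[where f="measure _"])
  also have "\<dots> = (\<Sum>n<k. ?p * (1 / real B) ^ n)"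
    using p by (subst measure_measure_pmf_finite) (auto simp: mult.commute)
  also have "\<dots> = 1 - (1 / real B) ^ k"
    unfolding one_diff_power_eq sum_distrib_left ..
  finally show ?thesis by (simp add: power_divide)
qed

text \<open>Each of \<open>B ^ k\<close> weights reaches \<open>2 ^ k\<close> with probability
  \<open>1 / B ^ k\<close>, so none does with probability at most
  \<open>exp (- 1) \<le> 1 / 2\<close>.\<close>

lemma expected_max_dyadic_law:
  assumes B: "4 \<le> B" and N: "B ^ k \<le> N"
  shows "2 ^ k / 2 \<le> expected_max N (dyadic_law B) (B ^ k)"
proof -
  let ?n = "B ^ k"
  have n: "1 \<le> ?n" using B by simp
  have n': "1 / real ?n \<le> 1"
    using B power_le_one[of "1 / real B" k] by (simp add: power_divide)
  have "(1 - 1 / real ?n) ^ ?n \<le> exp (- 1 / real ?n) ^ ?n"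
    using n n' exp_ge_add_one_self[of "- 1 / real ?n"] by (intro power_mono) auto
  also have "\<dots> = exp (- 1)"
    using n B by (simp add: exp_of_nat_mult[symmetric])
  also have "\<dots> \<le> 1 / 2"
    using exp_ge_add_one_self[of 1] by (simp add: exp_minus field_simps)
  finally have "(1 - 1 / real ?n) ^ ?n \<le> 1 / 2" .
  then have "2 ^ k / 2 \<le> 2 ^ k * (1 - (1 - 1 / real ?n) ^ ?n)"
    by (simp add: field_simps)
  also have "\<dots> = 2 ^ k * (1 - measure (dyadic_law B) {..<2 ^ k} ^ ?n)"
    by (simp add: measure_dyadic_law_lessThan[OF B])
  also have "\<dots> \<le> expected_max N (dyadic_law B) ?n"
    using expected_max_ge[OF weight_distribution_dyadic_law[OF B] n N] by simp
  finally show ?thesis .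
qed

section \<open>Upper bound for every algorithm under the dyadic law\<close>

lemma sum_half_powers_tail_le:
  fixes g K :: nat
  shows "(\<Sum>k=g..K. (1 / 2 :: real) ^ k) \<le> 2 * (1 / 2) ^ g"
proof -
  \<comment> \<open>Enlarging the upper limit to \<open>K + g\<close> permits a shift by
    \<open>g\<close> without a case distinction on \<open>g \<le> K\<close>.\<close>
  have "(\<Sum>k=g..K. (1 / 2 :: real) ^ k) \<le> (\<Sum>k=g..K+g. (1 / 2) ^ k)"
    by (intro sum_mono2) auto
  also have "\<dots> = (\<Sum>k\<in>{0..K}. (1 / 2) ^ g * (1 / 2) ^ k)"
    using sum.shift_bounds_cl_nat_ivl[of "\<lambda>k. (1 / 2 :: real) ^ k" 0 g K]
    by (simp add: power_add mult.commute)
  also have "\<dots> = (1 / 2) ^ g * (\<Sum>k\<in>{0..K}. (1 / 2) ^ k)"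
    by (simp add: sum_distrib_left)
  also have "\<dots> \<le> (1 / 2) ^ g * 2"
  proof (intro mult_left_mono)
    have "(\<Sum>k\<in>{0..K}. (1 / 2 :: real) ^ k) = 2 - (1 / 2) ^ K"
      by (induction K) auto
    then show "(\<Sum>k\<in>{0..K}. (1 / 2 :: real) ^ k) \<le> 2" by simp
  qed simp
  finally show ?thesis by simp
qed

text \<open>Let \<open>B ^ g\<close> be the first time at which \<open>i\<close> has arrived. Then
  \<open>L \<le> 2 * (1 / 2) ^ g\<close>, so an excess over 2 needs a weight above
  \<open>2 ^ g\<close>, and the tail bound gives \<open>(8 / B) * (1 / B ^ g)\<close>. This is
  relaxed to a sum over all later times, which is easy to add up over \<open>i\<close>.\<close>

lemma dyadic_excess_le:
  fixes K B i :: nat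
  assumes B: "4 \<le> B"
  defines "L \<equiv> \<Sum>k\<in>{k\<in>{..K}. i \<le> B ^ k}. (1 / 2 :: real) ^ k"
  shows "(\<integral>x. (if 2 < L * x then L * x else 0) \<partial>dyadic_law B)
      \<le> (8 / B) * (\<Sum>k\<in>{k\<in>{..K}. i \<le> B ^ k}. 1 / real B ^ k)"
proof (cases "i \<le> B ^ K")
  case False
  \<comment> \<open>A candidate arriving after the last time \<open>B ^ K\<close> contributes
    nothing.\<close>
  have e: "{k\<in>{..K}. i \<le> B ^ k} = {}"
    using False B power_increasing[of _ K B] by (force intro: order_trans)
  have "L = 0" by (simp only: L_def e sum.empty)
  then show ?thesis unfolding e by simp
next
  case True
  define g where "g = (LEAST k. i \<le> B ^ k)"
  have g: "i \<le> B ^ g" unfolding g_def using True by (rule LeastI)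
  have least: "g \<le> k" if "i \<le> B ^ k" for k
    unfolding g_def using that by (rule Least_le)
  have gK: "g \<le> K" using least True by simp
  have "{k\<in>{..K}. i \<le> B ^ k} = {g..K}"
    using B g power_increasing[of g _ B] by (auto intro: least order_trans)
  then have L: "0 \<le> L" "L \<le> 2 * (1 / 2) ^ g"
    unfolding L_def using sum_half_powers_tail_le by (auto intro: sum_nonneg)
  let ?f = "\<lambda>x::real. if 2 ^ g < x then x else 0"
  note D = weight_distributionD[OF weight_distribution_dyadic_law[OF B]]
  have "(\<integral>x. (if 2 < L * x then L * x else 0) \<partial>dyadic_law B)
      \<le> (\<integral>x. 2 * (1 / 2) ^ g * ?f x \<partial>dyadic_law B)"
  proof (rule integral_mono_AE)
    show "integrable (dyadic_law B) (\<lambda>x. if 2 < L * x then L * x else 0)"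
    proof (rule Bochner_Integration.integrable_bound)
      show "integrable (dyadic_law B) (\<lambda>x. L * x)" using D(5) by simp
      show "(\<lambda>x. if 2 < L * x then L * x else 0) \<in> borel_measurable (dyadic_law B)"
        using D(2) by (simp cong: measurable_cong_sets)
    qed auto
    show "integrable (dyadic_law B) (\<lambda>x. 2 * (1 / 2) ^ g * ?f x)"
      by (intro integrable_mult_right dyadic_law_tail B)
    show "AE x in dyadic_law B. (if 2 < L * x then L * x else 0) \<le> 2 * (1 / 2) ^ g * ?f x"
      using D(4)
    proof eventually_elim
      case (elim x)
      then have le: "L * x \<le> 2 * (1 / 2) ^ g * x"
        using L by (intro mult_right_mono)
      then have "2 ^ g < x" if "2 < L * x"
      proof -
          have "2 < 2 * (1 / 2) ^ g * x" using that le by linarith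
          then show ?thesis by (simp add: field_simps power_divide)
        qed
      with le elim show ?case by auto
    qed
  qed
  also have "\<dots> = 2 * (1 / 2) ^ g * (\<integral>x. ?f x \<partial>dyadic_law B)"
    by (rule integral_mult_right_zero)
  also have "\<dots> \<le> 2 * (1 / 2) ^ g * (2 * (2 / real B) ^ Suc g)"
    by (intro mult_left_mono dyadic_law_tail B) simp
  also have "\<dots> = (8 / B) * (1 / real B ^ g)"
    by (simp add: power_divide)
  \<comment> \<open>The left side is the term \<open>k = g\<close> of the sum.\<close>
  also have "\<dots> \<le> (8 / B) * (\<Sum>k\<in>{k\<in>{..K}. i \<le> B ^ k}. 1 / real B ^ k)"
    using g gK by (intro mult_left_mono member_le_sum) auto
  finally show ?thesis .
qed

text \<open>In the double sum of the excess bounds, each \<open>k\<close> has exactly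
  \<open>B ^ k\<close> candidates with share \<open>1 / B ^ k\<close>, hence contributes 1 in
  total.\<close>

lemma weighted_expected_selected_dyadic_le:
  assumes B: "4 \<le> B" and N: "B ^ K \<le> N" and alg: "online_algorithm N R A"
  shows "(\<Sum>k\<le>K. (1 / 2) ^ k * expected_selected N (dyadic_law B) R A (B ^ k))
      \<le> 2 + (8 / B) * (real K + 1)"
proof -
  have le: "B ^ k \<le> N" if "k \<in> {..K}" for k
  proof -
    have "B ^ k \<le> B ^ K" using that B by (intro power_increasing) auto
    then show ?thesis using N by simp
  qed
  have "(\<Sum>k\<le>K. (1 / 2) ^ k * expected_selected N (dyadic_law B) R A (B ^ k))
      \<le> 2 + (\<Sum>i\<in>{1..N}. \<integral>x.
          (if 2 < (\<Sum>k\<in>{k\<in>{..K}. i \<le> B ^ k}. (1 / 2) ^ k) * x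
           then (\<Sum>k\<in>{k\<in>{..K}. i \<le> B ^ k}. (1 / 2) ^ k) * x else 0) \<partial>dyadic_law B)"
    by (rule weighted_expected_selected_le[OF alg weight_distribution_dyadic_law[OF B]])
       (use le in auto)
  also have "\<dots> \<le> 2 + (\<Sum>i\<in>{1..N}. (8 / B) * (\<Sum>k\<in>{k\<in>{..K}. i \<le> B ^ k}. 1 / real B ^ k))"
    by (intro add_left_mono sum_mono dyadic_excess_le B)
  also have "(\<Sum>i\<in>{1..N}. (8 / B) * (\<Sum>k\<in>{k\<in>{..K}. i \<le> B ^ k}. 1 / real B ^ k))
     = (8 / B) * (\<Sum>i\<in>{1..N}. \<Sum>k\<in>{k\<in>{..K}. i \<le> B ^ k}. 1 / real B ^ k)"
    by (simp add: sum_distrib_left)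
  also have "(\<Sum>i\<in>{1..N}. \<Sum>k\<in>{k\<in>{..K}. i \<le> B ^ k}. 1 / real B ^ k)
     = (\<Sum>k\<le>K. \<Sum>i\<in>{i\<in>{1..N}. i \<le> B ^ k}. 1 / real B ^ k)"
    by (rule sum.swap_restrict) auto
  also have "\<dots> = (\<Sum>k\<le>K. 1)"
  proof (rule sum.cong[OF refl])
    fix k assume "k \<in> {..K}"
    then have "{i\<in>{1..N}. i \<le> B ^ k} = {1..B ^ k}" using le[of k] by auto
    then show "(\<Sum>i\<in>{i\<in>{1..N}. i \<le> B ^ k}. 1 / real B ^ k) = 1" using B by simp
  qed
  finally show ?thesis by (simp add: add.commute)
qed

section \<open>Choice of parameters and conclusion\<close>

theorem theorem6:
  fixes N :: nat
  assumes "N \<ge> 3"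
  shows "\<exists>D. weight_distribution D \<and>
           (\<forall>R A. online_algorithm N R A \<longrightarrow>
              (\<exists>n\<in>{1..N}. expected_selected N D R A n
                 \<le> 32 * log 2 (log 2 (real N)) / log 2 (real N) * expected_max N D n))"
proof -
  define l where "l = log 2 (real N)"
  define c where "c = 32 * log 2 l / l"
  \<comment> \<open>This follows from \<open>8 \<le> 9\<close>. It keeps \<open>log 2 l\<close> away
    from 0 even for \<open>N = 3\<close>.\<close>
  have "3 / 2 \<le> log 2 3"
  proof -
    have "3 = log 2 ((2::real) ^ 3)" by (subst log_nat_power) auto
    also have "\<dots> \<le> log 2 (3 ^ 2)" by (subst log_le_cancel_iff) auto
    also have "\<dots> = 2 * log 2 3" by (subst log_nat_power) auto
    finally show ?thesis by simp
  qed
  also have "\<dots> \<le> l" unfolding l_def using assms by simp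
  finally have l: "3 / 2 \<le> l" .
  have "1 / 2 \<le> log 2 (3 / 2)"
  proof -
    have "1 = log 2 (2::real)" by simp
    also have "\<dots> \<le> log 2 ((3 / 2) ^ 2)" by (subst log_le_cancel_iff) (auto simp: power2_eq_square)
    also have "\<dots> = 2 * log 2 (3 / 2)" by (subst log_nat_power) auto
    finally show ?thesis by simp
  qed
  also have "\<dots> \<le> log 2 l" using l by simp
  finally have ll: "1 / 2 \<le> log 2 l" .
  show ?thesis
  proof (cases "log 2 l \<le> 4")
    case True
    \<comment> \<open>The claimed ratio is at least 1, so \<open>n = 1\<close> works.\<close>
    then have "l \<le> 2 powr 4" using l by (simp add: log_le_iff)
    \<comment> \<open>Here \<open>l \<le> 16\<close> and \<open>log 2 l \<ge> 1 / 2\<close>, so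
      \<open>32 * log 2 l \<ge> 16 \<ge> l\<close>.\<close>
    then have c: "1 \<le> c" using ll l by (simp add: c_def field_simps)
    let ?D = "dyadic_law 4"
    have D: "weight_distribution ?D" by (rule weight_distribution_dyadic_law) simp
    have "\<exists>n\<in>{1..N}. expected_selected N ?D R A n \<le> c * expected_max N ?D n"
      if alg: "online_algorithm N R A" for R A
    proof
      show "1 \<in> {1..N}" using assms by simp
      \<comment> \<open>The general bound with the single time 1, weight 1 and threshold
        \<open>a = 0\<close>: only the first candidate counts, with its positive part.\<close>
      have "expected_selected N ?D R A 1
          \<le> (\<Sum>i\<in>{1..N}. \<integral>x. (if i = 1 \<and> 0 < x then x else 0) \<partial>?D)"
      proof -
        have L: "(\<Sum>k\<in>{k\<in>{1::nat}. i \<le> k}. 1 :: real) = (if i = 1 then 1 else 0)"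
          if "i \<in> {1..N}" for i
        proof -
          have "{k\<in>{1::nat}. i \<le> k} = (if i = 1 then {1} else {})" using that by auto
          then show ?thesis by simp
        qed
        have "expected_selected N ?D R A 1 \<le> 0 + (\<Sum>i\<in>{1..N}.
            \<integral>x. (if 0 < (\<Sum>k\<in>{k\<in>{1::nat}. i \<le> k}. 1) * x
                then (\<Sum>k\<in>{k\<in>{1::nat}. i \<le> k}. 1) * x else 0) \<partial>?D)"
          using weighted_expected_selected_le[OF alg D, of "{1::nat}" "\<lambda>_. 1" "\<lambda>k. k" 0] assms
          by simp
        also have "\<dots> = (\<Sum>i\<in>{1..N}. \<integral>x. (if i = 1 \<and> 0 < x then x else 0) \<partial>?D)"
          unfolding add_0
          by (intro sum.cong Bochner_Integration.integral_cong refl) (simp only: L, auto)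
        finally show ?thesis .
      qed
      also have "\<dots> = (\<Sum>i\<in>{1..N}. if i = 1 then (\<integral>x. (if 0 < x then x else 0) \<partial>?D) else 0)"
        by (intro sum.cong) auto
      also have "\<dots> = (\<integral>x. (if 0 < x then x else 0) \<partial>?D)" using assms by simp
      also have "\<dots> = (\<integral>x. x \<partial>?D)"
      proof (rule integral_cong_AE)
        show "AE x in ?D. (if 0 < x then x else 0) = x"
          using weight_distributionD(4)[OF D] by eventually_elim auto
      qed (simp_all add: dyadic_law_def)
      also have "\<dots> = 1 * expected_max N ?D 1"
        using expected_max_1[OF D] assms by simp
      also have "\<dots> \<le> c * expected_max N ?D 1"
        using expected_max_1[OF D] assms c D
        by (intro mult_right_mono) (auto simp: weight_distribution_def)
      finally show "expected_selected N ?D R A 1 \<le> c * expected_max N ?D 1" .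
    qed
    then show ?thesis
      using D unfolding c_def l_def by blast
  next
    case False
    \<comment> \<open>Rounding up the logarithm gives \<open>l \<le> B\<close>, which keeps the
      excess \<open>8 * (K + 1) / B\<close> bounded. \<open>K\<close> counts how often
      \<open>m\<close> fits into \<open>l\<close>, so that
      \<open>B ^ K = 2 ^ (m * K) \<le> N\<close>.\<close>
    define m where "m = nat \<lceil>log 2 l\<rceil>"
    define B :: nat where "B = 2 ^ m"
    define K where "K = nat \<lfloor>l / m\<rfloor>"
    have m: "log 2 l \<le> m" "real m \<le> log 2 l + 1" "5 \<le> m"
      using False unfolding m_def by linarith+
    have "2 powr (log 2 l) \<le> 2 powr real m" using m by simp
    then have lB: "l \<le> B" using l by (simp add: B_def powr_realpow)
    have "(2::nat) ^ 5 \<le> B" unfolding B_def using m by (intro power_increasing) auto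
    then have B: "32 \<le> B" by simp
    have K: "real K \<le> l / m" "l / m \<le> real K + 1"
      using l m unfolding K_def by (auto simp: le_nat_iff) 
    have "real (m * K) \<le> l"
      using K(1) m by (simp add: field_simps)
    then have "2 powr real (m * K) \<le> 2 powr l" by simp
    also have "2 powr l = real N" using assms by (simp add: l_def)
    also have "2 powr real (m * K) = real (B ^ K)"
      by (simp add: powr_realpow B_def power_mult del: of_nat_mult)
    finally have BK: "B ^ K \<le> N" by (simp only: of_nat_le_iff)
    let ?D = "dyadic_law B"
    have D: "weight_distribution ?D" using B by (intro weight_distribution_dyadic_law) simp
    have "\<exists>n\<in>{1..N}. expected_selected N ?D R A n \<le> c * expected_max N ?D n"
      if alg: "online_algorithm N R A" for R A
    proof (rule ccontr)
      assume "\<not> ?thesis"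
      then have gt: "c * expected_max N ?D n < expected_selected N ?D R A n" if "n \<in> {1..N}" for n
        using that by force
      have c0: "0 \<le> c" using ll l by (simp add: c_def)
      \<comment> \<open>Beating ratio \<open>c\<close> at time \<open>B ^ k\<close> earns at least
        \<open>c * 2 ^ k / 2\<close>, that is \<open>c / 2\<close> after scaling by
        \<open>(1 / 2) ^ k\<close>.\<close>
      have "c / 2 * (real K + 1) = (\<Sum>k\<le>K. c / 2)"
        by simp
      also have "\<dots> \<le> (\<Sum>k\<le>K. (1 / 2) ^ k * expected_selected N ?D R A (B ^ k))"
      proof (rule sum_mono)
        fix k assume "k \<in> {..K}"
        then have "B ^ k \<le> B ^ K" using B by (intro power_increasing) auto
        then have le: "B ^ k \<le> N" using BK by simp
        have "c / 2 = (1 / 2) ^ k * (c * (2 ^ k / 2))"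
          by (simp add: power_divide)
        also have "\<dots> \<le> (1 / 2) ^ k * (c * expected_max N ?D (B ^ k))"
          using B le c0 by (intro mult_left_mono expected_max_dyadic_law) auto
        also have "\<dots> \<le> (1 / 2) ^ k * expected_selected N ?D R A (B ^ k)"
          using gt[of "B ^ k"] le B by (intro mult_left_mono) auto
        finally show "c / 2 \<le> (1 / 2) ^ k * expected_selected N ?D R A (B ^ k)" .
      qed
      also have "\<dots> \<le> 2 + (8 / B) * (real K + 1)"
        using B by (intro weighted_expected_selected_dyadic_le BK alg) simp
      \<comment> \<open>From \<open>m \<ge> 5\<close> and \<open>l \<le> B\<close> comes
        \<open>K \<le> B / 5\<close>; then \<open>8 * (B / 5 + 1) \<le> 2 * B\<close> holds as soon
        as \<open>B \<ge> 20\<close>.\<close>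
      also have "(8 / B) * (real K + 1) \<le> 2"
      proof -
        have "l / m \<le> l / 5" using l m by (intro divide_left_mono) auto
        then have "real K \<le> B / 5" using K lB by linarith
        then have "8 * (real K + 1) \<le> 2 * B" using B by simp
        then show ?thesis using B by (simp add: field_simps)
      qed
      finally have "c * (real K + 1) \<le> 8" by simp
      moreover have "16 \<le> c * (real K + 1)"
      proof -
        \<comment> \<open>Since \<open>log 2 l\<close> exceeds 4, rounding up at most doubles it:
          \<open>m \<le> log 2 l + 1 \<le> 2 * log 2 l\<close>. The constant 32 then yields 16
          against the upper bound 8.\<close>
        have "16 * real m \<le> 32 * log 2 l" using m ll by linarith
        then have "16 \<le> c * (l / m)"
          using l m by (simp add: c_def field_simps)
        also have "\<dots> \<le> c * (real K + 1)" using K c0 by (intro mult_left_mono)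
        finally show ?thesis .
      qed
      ultimately show False by simp
    qed
    then show ?thesis
      using D unfolding c_def l_def by blast
  qed
qed

end
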